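(* Let $G$ be an edge-colored complete graph on $n$ vertices. If $\Delta^{mon}(G)\leq n-5$, then $G$ contains two vertex-disjoint properly colored cycles, each of length at most $4$.
   Context: All graphs are finite and simple. An edge-colored graph is a graph with an arbitrary mapping $col:E(G)\to\mathbb{N}$ (not necessarily a proper coloring). For a color $i$, $G^i$ is the spanning subgraph of $G$ formed by the edges of color $i$, and $\Delta^{mon}(G)=\max_i \Delta(G^i)$ (maximum over the colors $i$ appearing in $G$) is the maximum monochromatic degree. A cycle is properly colored (PC) if any two adjacent edges of the cycle have distinct colors. *)

theory Defs
  imports Main
begin

definition simple_graph :: "'a set \<Rightarrow> 'a set set \<Rightarrow> bool" where
  "simple_graph V E \<longleftrightarrow> finite V \<and> (\<forall>e\<in>E. e \<subseteq> V \<and> card e = 2)"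

definition complete_graph :: "'a set \<Rightarrow> 'a set set \<Rightarrow> bool" where
  "complete_graph V E \<longleftrightarrow>
     simple_graph V E \<and> (\<forall>u\<in>V. \<forall>v\<in>V. u \<noteq> v \<longrightarrow> {u, v} \<in> E)"

definition degree :: "'a set set \<Rightarrow> 'a \<Rightarrow> nat" where
  "degree E v = card {e \<in> E. v \<in> e}"

(* Meaningful only for finite nonempty V. *)
definition max_degree :: "'a set \<Rightarrow> 'a set set \<Rightarrow> nat" where
  "max_degree V E = Max (degree E ` V)"

(* Edge set of the spanning subgraph of color i; its vertex set is that of the whole graph. *)
definition color_edges :: "'a set set \<Rightarrow> ('a set \<Rightarrow> nat) \<Rightarrow> nat \<Rightarrow> 'a set set" where
  "color_edges E col i = {e \<in> E. col e = i}"

(* The maximum ranges over the colors that appear. An edgeless graph has no colors and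
   gets the value 0. *)
definition max_mono_degree :: "'a set \<Rightarrow> 'a set set \<Rightarrow> ('a set \<Rightarrow> nat) \<Rightarrow> nat" where
  "max_mono_degree V E col =
     (if E = {} then 0 else Max ((\<lambda>i. max_degree V (color_edges E col i)) ` (col ` E)))"

(* A cycle is given by the list of its vertices in cyclic order, the first one not being
   repeated at the end; its length as a cycle is the length of the list. *)
definition cycle_edges :: "'a list \<Rightarrow> 'a set set" where
  "cycle_edges c = {{c ! i, c ! (Suc i mod length c)} | i. i < length c}"

definition is_cycle :: "'a set \<Rightarrow> 'a set set \<Rightarrow> 'a list \<Rightarrow> bool" where
  "is_cycle V E c \<longleftrightarrow>
     length c \<ge> 3 \<and> distinct c \<and> set c \<subseteq> V \<and> cycle_edges c \<subseteq> E"

definition properly_colored :: "('a set \<Rightarrow> nat) \<Rightarrow> 'a list \<Rightarrow> bool" where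
  "properly_colored col c \<longleftrightarrow>
     (\<forall>e\<in>cycle_edges c. \<forall>f\<in>cycle_edges c. e \<noteq> f \<and> e \<inter> f \<noteq> {} \<longrightarrow> col e \<noteq> col f)"

definition pc_cycle :: "'a set \<Rightarrow> 'a set set \<Rightarrow> ('a set \<Rightarrow> nat) \<Rightarrow> 'a list \<Rightarrow> bool" where
  "pc_cycle V E col c \<longleftrightarrow> is_cycle V E c \<and> properly_colored col c"

end

theory Submission
  imports Defs
begin

text \<open>
  A complete graph without properly coloured cycles of length 3 or 4 has a vertex all of whose
  edges have the same colour. Hence in a counterexample, deleting a properly coloured cycle of
  length at most 4 leaves a vertex that is monochromatic in the rest. For a rainbow triangle its
  monochromatic degree would be at least \<open>n - 4\<close>, so there is no rainbow triangle; for a properly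
  coloured quadrangle \<open>C\<close> the degree bound \<open>n - 5\<close> is attained, so this vertex \<open>a\<close> sends a colour
  \<open>r\<close> to the rest of \<open>V - C\<close> and only other colours to \<open>C\<close>. One then finds further properly
  coloured quadrangles \<open>x a z y\<close> with \<open>x\<close> in \<open>C\<close> and \<open>y\<close>, \<open>z\<close> outside, applies the same
  observation to each of them, and compares the resulting dominating vertices until the colours
  are forced into contradiction.
\<close>

section \<open>Short properly coloured cycles as vertex sets\<close>

text \<open>Colours are a function of two vertices, which keeps the combinatorial argument free of
  edge sets and vertex lists; the theorem instantiates it with \<open>col {u, v}\<close>.\<close>

definition rainbow_triangle :: "('a \<Rightarrow> 'a \<Rightarrow> 'c) \<Rightarrow> 'a \<Rightarrow> 'a \<Rightarrow> 'a \<Rightarrow> bool" where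
  "rainbow_triangle f a b c \<longleftrightarrow>
     distinct [a, b, c] \<and> f a b \<noteq> f b c \<and> f b c \<noteq> f c a \<and> f c a \<noteq> f a b"

definition pc_quadrangle :: "('a \<Rightarrow> 'a \<Rightarrow> 'c) \<Rightarrow> 'a \<Rightarrow> 'a \<Rightarrow> 'a \<Rightarrow> 'a \<Rightarrow> bool" where
  "pc_quadrangle f a b c d \<longleftrightarrow>
     distinct [a, b, c, d] \<and> f a b \<noteq> f b c \<and> f b c \<noteq> f c d \<and> f c d \<noteq> f d a \<and> f d a \<noteq> f a b"

text \<open>Only the vertex set is recorded, since two cycles are compared only for
  disjointness.\<close>

definition short_pc_set :: "('a \<Rightarrow> 'a \<Rightarrow> 'c) \<Rightarrow> 'a set \<Rightarrow> bool" where
  "short_pc_set f S \<longleftrightarrow>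
     (\<exists>a b c. rainbow_triangle f a b c \<and> S = {a, b, c}) \<or>
     (\<exists>a b c d. pc_quadrangle f a b c d \<and> S = {a, b, c, d})"

lemma short_pc_set_triangle: "rainbow_triangle f a b c \<Longrightarrow> short_pc_set f {a, b, c}"
  unfolding short_pc_set_def by blast

lemma short_pc_set_quadrangle: "pc_quadrangle f a b c d \<Longrightarrow> short_pc_set f {a, b, c, d}"
  unfolding short_pc_set_def by blast

text \<open>Induction adding \<open>v\<close>. Unless \<open>z\<close> or \<open>v\<close> is
  monochromatic, some \<open>j\<close> has \<open>f v j \<noteq> f v z\<close>. Excluding the
  rainbow triangle \<open>v z j\<close> forces \<open>f v j = c\<close>, and excluding the
  quadrangles \<open>v z u j\<close> makes \<open>j\<close> monochromatic in
  \<open>c\<close>.\<close>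

lemma ex_monochromatic_vertex:
  fixes f :: "'a \<Rightarrow> 'a \<Rightarrow> 'c"
  assumes sym: "\<And>u v. f u v = f v u"
    and "finite V" "V \<noteq> {}" "\<And>S. S \<subseteq> V \<Longrightarrow> \<not> short_pc_set f S"
  shows "\<exists>z\<in>V. \<exists>c. \<forall>u\<in>V - {z}. f z u = c"
  using assms(2-)
proof (induction V rule: finite_ne_induct)
  case (singleton x)
  then show ?case by auto
next
  case (insert v F)
  have "\<not> short_pc_set f S" if "S \<subseteq> F" for S
    using insert.prems that by blast
  then obtain z c where z: "z \<in> F" "\<And>u. u \<in> F \<Longrightarrow> u \<noteq> z \<Longrightarrow> f z u = c"
    using insert.IH by blast
  have vz: "v \<noteq> z" using z insert.hyps by blast
  consider "f z v = c" | "\<forall>u\<in>F. f v u = f v z"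
    | j where "f z v \<noteq> c" "j \<in> F" "f v j \<noteq> f v z" by blast
  then show ?case
  proof cases
    case 1
    then have "\<forall>u\<in>insert v F - {z}. f z u = c" using z by auto
    then show ?thesis using z by blast
  next
    case 2
    then have "\<forall>u\<in>insert v F - {v}. f v u = f v z" by auto
    then show ?thesis by blast
  next
    case (3 j)
    have j: "j \<noteq> z" "j \<noteq> v" using 3 insert.hyps by auto
    have vj: "f v j = c"
    proof (rule ccontr)
      assume "f v j \<noteq> c"
      then have "rainbow_triangle f v z j"
        using 3 j vz z sym unfolding rainbow_triangle_def
        by (metis distinct_length_2_or_more distinct_singleton)
      from short_pc_set_triangle[OF this] show False
        using insert.prems[of "{v, z, j}"] z(1) 3(2) by blast
    qed
    have "f j u = c" if u: "u \<in> insert v F - {j}" for u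
    proof (rule ccontr)
      assume ne: "f j u \<noteq> c"
      then have uv: "u \<noteq> v" "u \<noteq> z" "u \<noteq> j" "u \<in> F"
        using vj sym z 3 j u by (metis, metis, auto)
      then have "pc_quadrangle f v z u j"
        using 3 j vz vj ne z(2)[of u] sym[of v z] sym[of u j] sym[of j v]
        unfolding pc_quadrangle_def by auto
      from short_pc_set_quadrangle[OF this] show False
        using insert.prems[of "{v, z, u, j}"] z(1) 3(2) uv(4) by blast
    qed
    then show ?thesis using 3 by blast
  qed
qed

section \<open>Structure of a counterexample\<close>

text \<open>These assumptions describe a counterexample and are refuted by
  \<open>inconsistent\<close>. The additive degree bound avoids truncated subtraction.\<close>

locale no_disjoint_short_pc =
  fixes V :: "'a set" and f :: "'a \<Rightarrow> 'a \<Rightarrow> 'c"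
  assumes finV: "finite V"
    and sym: "f u v = f v u"
    and mono_degree: "v \<in> V \<Longrightarrow> card {u \<in> V. u \<noteq> v \<and> f v u = i} + 5 \<le> card V"
    and cardV: "card V \<ge> 6"
    and no_disjoint: "\<lbrakk>S \<subseteq> V; T \<subseteq> V; short_pc_set f S; short_pc_set f T\<rbrakk> \<Longrightarrow> S \<inter> T \<noteq> {}"
begin

lemma mono_neighbours:
  assumes "v \<in> V" "U \<subseteq> V" "v \<notin> U" "\<And>u. u \<in> U \<Longrightarrow> f v u = i"
  shows "card U + 5 \<le> card V"
proof -
  have "card U \<le> card {u \<in> V. u \<noteq> v \<and> f v u = i}"
    using assms finV by (intro card_mono) auto
  then show ?thesis using mono_degree[OF assms(1), of i] by linarith
qed

lemma dominating_vertex: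
  assumes "S \<subseteq> V" "short_pc_set f S" "U \<subseteq> V" "U \<inter> S = {}" "U \<noteq> {}"
  obtains a c where "a \<in> U" "\<And>u. u \<in> U \<Longrightarrow> u \<noteq> a \<Longrightarrow> f a u = c"
proof -
  have "\<not> short_pc_set f T" if "T \<subseteq> U" for T
    using no_disjoint[of S T] assms that by blast
  then have "\<exists>z\<in>U. \<exists>c. \<forall>u\<in>U - {z}. f z u = c"
    using assms finV by (intro ex_monochromatic_vertex[OF sym]) (auto intro: finite_subset)
  then show ?thesis using that by blast
qed

text \<open>A dominating vertex of the complement would have \<open>card V - 4\<close> edges of one
  colour, one too many.\<close>

lemma no_rainbow_triangle:
  assumes "a \<in> V" "b \<in> V" "c \<in> V"
  shows "\<not> rainbow_triangle f a b c"
proof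
  assume r: "rainbow_triangle f a b c"
  let ?S = "{a, b, c}"
  have "card ?S = 3" using r by (auto simp: rainbow_triangle_def)
  then have R: "card (V - ?S) = card V - 3"
    using assms by (subst card_Diff_subset) auto
  then have "V - ?S \<noteq> {}" using cardV by force
  then obtain z i where z: "z \<in> V - ?S" "\<And>u. u \<in> V - ?S \<Longrightarrow> u \<noteq> z \<Longrightarrow> f z u = i"
    using dominating_vertex[of ?S "V - ?S"] assms short_pc_set_triangle[OF r] by blast
  have "card (V - ?S - {z}) + 5 \<le> card V"
    by (rule mono_neighbours[of z _ i]) (use z in auto)
  then show False using R z cardV finV by (simp add: card_Diff_singleton)
qed

lemma third_colour:
  assumes "a \<in> V" "b \<in> V" "c \<in> V" "a \<noteq> b" "b \<noteq> c" "c \<noteq> a" "f a b \<noteq> f b c"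
  shows "f a c = f a b \<or> f a c = f b c"
  using no_rainbow_triangle[OF assms(1-3)] assms(4-) sym[of a c]
  unfolding rainbow_triangle_def by auto

text \<open>The edges from \<open>v\<close> to the rest of the complement already number
  \<open>card V - 5\<close>, so one more edge of colour \<open>p\<close>, into the quadrangle, would
  break the degree bound.\<close>

lemma quadrangle_exchange:
  assumes q: "pc_quadrangle f x1 x2 x3 x4" and sub: "{x1, x2, x3, x4} \<subseteq> V"
  obtains v p where "v \<in> V - {x1, x2, x3, x4}"
    "\<And>u. u \<in> V - {x1, x2, x3, x4} \<Longrightarrow> u \<noteq> v \<Longrightarrow> f v u = p"
    "\<And>x. x \<in> {x1, x2, x3, x4} \<Longrightarrow> f v x \<noteq> p"
proof -
  let ?S = "{x1, x2, x3, x4}"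
  have "card ?S = 4" using q by (auto simp: pc_quadrangle_def)
  then have R: "card (V - ?S) = card V - 4"
    using sub by (subst card_Diff_subset) auto
  then have "V - ?S \<noteq> {}" using cardV by force
  then obtain v p where v: "v \<in> V - ?S" "\<And>u. u \<in> V - ?S \<Longrightarrow> u \<noteq> v \<Longrightarrow> f v u = p"
    using dominating_vertex[OF sub short_pc_set_quadrangle[OF q], of "V - ?S"] by blast
  have "f v x \<noteq> p" if x: "x \<in> ?S" for x
  proof
    assume "f v x = p"
    then have "card (insert x (V - ?S - {v})) + 5 \<le> card V"
      using v x sub by (intro mono_neighbours[of v _ p]) auto
    moreover have "x \<notin> V - ?S - {v}" using x by blast
    ultimately show False using R v cardV finV by (simp add: card_Diff_singleton)
  qed
  then show ?thesis using that v by blast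
qed

lemma inconsistent: False
proof -
  have "V \<noteq> {}" using cardV by auto
  have "\<exists>S\<subseteq>V. short_pc_set f S"
  proof (rule ccontr)
    assume "\<not> ?thesis"
    then have "\<not> short_pc_set f S" if "S \<subseteq> V" for S
      using that by blast
    from ex_monochromatic_vertex[OF sym finV \<open>V \<noteq> {}\<close> this]
    obtain z c where z: "z \<in> V" "\<And>u. u \<in> V - {z} \<Longrightarrow> f z u = c"
      by blast
    have "card (V - {z}) + 5 \<le> card V"
      by (rule mono_neighbours[of z _ c]) (use z in auto)
    then show False using z cardV finV by (simp add: card_Diff_singleton)
  qed
  then obtain S where S: "S \<subseteq> V" "short_pc_set f S" by blast
  obtain c1 c2 c3 c4 where q: "pc_quadrangle f c1 c2 c3 c4" and sub: "{c1, c2, c3, c4} \<subseteq> V"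
    using S(2) unfolding short_pc_set_def
  proof (elim disjE exE conjE)
    fix a b c assume "rainbow_triangle f a b c" "S = {a, b, c}"
    then show thesis using no_rainbow_triangle[of a b c] S(1) by simp
  next
    fix a b c d assume "pc_quadrangle f a b c d" "S = {a, b, c, d}"
    then show thesis using that[of a b c d] S(1) by simp
  qed
  define C where "C = {c1, c2, c3, c4}"
  have CV: "C \<subseteq> V" and cardC: "card C = 4" and pcC: "short_pc_set f C"
    using sub q short_pc_set_quadrangle[OF q] by (auto simp: C_def pc_quadrangle_def)
  have finC: "finite C" by (simp add: C_def)
  have C_avoid: "\<exists>x\<in>C. x \<noteq> u \<and> x \<noteq> v" for u v
  proof (rule ccontr)
    assume "\<not> ?thesis"
    then have "C \<subseteq> {u, v}" by blast
    then have "card C \<le> card {u, v}" by (intro card_mono) auto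
    also have "\<dots> \<le> 2" by (simp add: card_insert_if)
    finally show False using cardC by simp
  qed
  define R where "R = V - C"
  have RV: "R \<subseteq> V" and finR: "finite R" and cardR: "card R = card V - 4"
    using CV finV cardC finC by (auto simp: R_def card_Diff_subset)
  have CR: "x \<noteq> d" if "x \<in> C" "d \<in> R" for x d using that by (auto simp: R_def)
  obtain a r where a: "a \<in> R" and ar: "\<And>u. u \<in> R \<Longrightarrow> u \<noteq> a \<Longrightarrow> f a u = r"
    by (rule quadrangle_exchange[OF q sub, folded C_def, folded R_def]) (rule that)
  \<comment> \<open>\<open>A\<close> collects all vertices dominating \<open>R\<close> in colour
    \<open>r\<close>. Each vertex of \<open>D\<close> thus has an edge of another colour inside
    \<open>R\<close>, and its other end is again in \<open>D\<close>.\<close>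
  define A where "A = {u \<in> R. \<forall>v\<in>R - {u}. f u v = r}"
  define D where "D = R - A"
  have aA: "a \<in> A" using a ar by (auto simp: A_def)
  have AR: "A \<subseteq> R" and DR: "D \<subseteq> R" by (auto simp: A_def D_def)
  have A_r: "f u v = r" "f v u = r" if "u \<in> A" "v \<in> R" "u \<noteq> v" for u v
    using that sym by (auto simp: A_def)
  have AC: "f x u \<noteq> r" if "u \<in> A" "x \<in> C" for u x
  proof
    assume "f x u = r"
    have uR: "u \<in> R" using that AR by blast
    have "card (insert x (R - {u})) + 5 \<le> card V"
    proof (rule mono_neighbours[of u _ r])
      show "u \<in> V" "insert x (R - {u}) \<subseteq> V" "u \<notin> insert x (R - {u})"
        using that uR RV CV by (auto simp: R_def)
      show "f u v = r" if "v \<in> insert x (R - {u})" for v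
        using that A_r(1)[OF \<open>u \<in> A\<close>, of v] \<open>f x u = r\<close> sym[of u x] by auto
    qed
    moreover have "x \<notin> R - {u}" using that by (auto simp: R_def)
    ultimately show False using uR cardR cardV finR by (simp add: card_Diff_singleton)
  qed
  \<comment> \<open>Apart from \<open>d = u\<close>, the triangle \<open>x u d\<close> is not
    rainbow while \<open>f u d = r\<close> and \<open>f x u \<noteq> r\<close>.\<close>
  have C_two: "f x d = r \<or> f x d = f x u" if "x \<in> C" "u \<in> A" "d \<in> R" for x u d
  proof (cases "d = u")
    case False
    then have "f u d = r" using that A_r by blast
    moreover have "x \<in> V" "u \<in> V" "d \<in> V" "x \<noteq> u" "x \<noteq> d"
      using that RV CV AR by (auto simp: R_def)
    ultimately show ?thesis
      using third_colour[of x u d] AC[of u x] that False by auto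
  qed simp
  have C_A: "f x u = f x a" if "x \<in> C" "u \<in> A" for x u
    using C_two[of x a u] that AC aA AR by blast
  \<comment> \<open>Otherwise all \<open>card V - 4\<close> edges from \<open>x\<close> to
    \<open>R\<close> would have the colour \<open>f x a\<close>.\<close>
  have ex_r: "\<exists>y\<in>D. f x y = r" if x: "x \<in> C" for x
  proof (rule ccontr)
    assume "\<not> ?thesis"
    then have "f x d = f x a" if "d \<in> R" for d
      using C_two[OF x aA that] C_A[OF x] that by (auto simp: D_def)
    then have "card R + 5 \<le> card V"
      using x CV RV by (intro mono_neighbours[of x _ "f x a"]) (auto simp: R_def)
    then show False using cardR cardV by simp
  qed
  have CD: "x \<noteq> d" if "x \<in> C" "d \<in> D" for x d using that DR CR by blast
  have Ca: "x \<noteq> a" if "x \<in> C" for x using that a CR by blast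
  have ex_z: "\<exists>z\<in>D. z \<noteq> y \<and> f y z \<noteq> r" if "y \<in> D" for y
  proof -
    obtain z where z: "z \<in> R" "z \<noteq> y" "f y z \<noteq> r" and y: "y \<in> R"
      using \<open>y \<in> D\<close> by (auto simp: D_def A_def)
    then have "z \<notin> A" using A_r(2)[of z y] by blast
    then show ?thesis using z by (auto simp: D_def)
  qed
  \<comment> \<open>Around the cycle the colours alternate between not \<open>r\<close> and
    \<open>r\<close>.\<close>
  have cyc: "pc_quadrangle f x b z y" "{x, b, z, y} \<subseteq> V"
    if "x \<in> C" "b \<in> A" "y \<in> D" "z \<in> D" "y \<noteq> z" "f x y = r" "f y z \<noteq> r" for x b y z
  proof -
    have "distinct [x, b, z, y]" using that CR AR DR by (auto simp: D_def)
    moreover have "f b z = r" using that A_r DR by (auto simp: D_def)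
    ultimately show "pc_quadrangle f x b z y"
      using that AC[of b x] sym[of y x] sym[of y z] by (auto simp: pc_quadrangle_def)
    show "{x, b, z, y} \<subseteq> V" using that CV AR DR RV by auto
  qed
  obtain y0 z0 x0 where xyz0: "x0 \<in> C" "y0 \<in> D" "z0 \<in> D" "y0 \<noteq> z0" "f x0 y0 = r" "f y0 z0 \<noteq> r"
  proof -
    obtain x where x: "x \<in> C" using C_avoid by blast
    obtain y where y: "y \<in> D" "f x y = r" using ex_r[OF x] by blast
    obtain z where "z \<in> D" "z \<noteq> y" "f y z \<noteq> r" using ex_z[OF y(1)] by blast
    then show thesis using that[of x y z] x y by simp
  qed
  have finD: "finite D" and finA: "finite A" using finR DR AR finite_subset by auto
  \<comment> \<open>If \<open>D\<close> had only two elements, each would have at most one \<open>r\<close>-neighbour in \<open>C\<close>, as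
    \<open>n - 6\<close> of its \<open>r\<close>-edges go to \<open>A\<close>; but all four vertices of \<open>C\<close> have an \<open>r\<close>-neighbour in \<open>D\<close>.\<close>
  have D_avoid: "\<exists>d\<in>D. d \<noteq> y \<and> d \<noteq> z" for y z
  proof (rule ccontr)
    assume "\<not> ?thesis"
    then have "D \<subseteq> {y, z}" by blast
    moreover from this have "{y, z} \<subseteq> {y0, z0}" using xyz0(2-4) by auto
    ultimately have D: "D = {y0, z0}" using xyz0(2,3) by blast
    have cA: "card A = card V - 6"
    proof -
      have "A = R - {y0, z0}" using D AR by (auto simp: D_def)
      moreover have "card (R - {y0, z0}) = card R - card {y0, z0}"
        using xyz0 DR by (intro card_Diff_subset) auto
      ultimately show ?thesis using xyz0 cardR by simp
    qed
    have one: "card {x \<in> C. f x y = r} \<le> 1" if "y \<in> D" for y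
    proof -
      let ?X = "{x \<in> C. f x y = r}"
      have "card (A \<union> ?X) + 5 \<le> card V"
      proof (rule mono_neighbours[of y _ r])
        show "y \<in> V" "A \<union> ?X \<subseteq> V" "y \<notin> A \<union> ?X"
          using that DR RV CV AR by (auto simp: D_def R_def)
        show "f y u = r" if "u \<in> A \<union> ?X" for u
          using that A_r(2)[of u y] \<open>y \<in> D\<close> DR sym[of y u] by (auto simp: D_def)
      qed
      moreover have "A \<inter> ?X = {}" using AR by (auto simp: R_def)
      ultimately show ?thesis using cA finC finA cardV by (simp add: card_Un_disjoint)
    qed
    have "C \<subseteq> {x \<in> C. f x y0 = r} \<union> {x \<in> C. f x z0 = r}"
      using ex_r D by auto
    then have "card C \<le> card ({x \<in> C. f x y0 = r} \<union> {x \<in> C. f x z0 = r})"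
      using finC by (intro card_mono) auto
    also have "\<dots> \<le> 1 + 1"
      using card_Un_le[of "{x \<in> C. f x y0 = r}" "{x \<in> C. f x z0 = r}"] one[OF xyz0(2)] one[OF xyz0(3)]
      by linarith
    finally show False using cardC by simp
  qed
  \<comment> \<open>A dominating vertex in \<open>C\<close> or \<open>D\<close> would see
    \<open>b\<close> in colour \<open>p\<close> and \<open>a\<close> in another one, although it
    sees all of \<open>A\<close> in one colour. One in \<open>A\<close> would see \<open>d\<close>
    and \<open>x\<close> alike, but it sees \<open>D\<close> in colour \<open>r\<close> and
    \<open>C\<close> never in \<open>r\<close>.\<close>
  have A_single: "b = a" if b: "b \<in> A" for b
  proof (rule ccontr)
    assume ba: "b \<noteq> a"
    obtain v p where v: "v \<in> V - {x0, a, z0, y0}"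
      and vp: "\<And>u. u \<in> V - {x0, a, z0, y0} \<Longrightarrow> u \<noteq> v \<Longrightarrow> f v u = p"
      and vn: "\<And>x. x \<in> {x0, a, z0, y0} \<Longrightarrow> f v x \<noteq> p"
      by (rule quadrangle_exchange[OF cyc[OF xyz0(1) aA xyz0(2-)]]) (rule that)
    have bV: "b \<in> V - {x0, a, z0, y0}"
      using b ba xyz0 AR RV CR by (auto simp: D_def)
    obtain d where d: "d \<in> D" "d \<noteq> y0" "d \<noteq> z0" using D_avoid by blast
    have dV: "d \<in> V - {x0, a, z0, y0}"
      using d xyz0 aA DR RV CR by (auto simp: D_def)
    obtain x where x: "x \<in> C" "x \<noteq> x0" using C_avoid by blast
    have xV: "x \<in> V - {x0, a, z0, y0}"
      using x CV Ca[OF x(1)] CD[OF x(1) xyz0(2)] CD[OF x(1) xyz0(3)] by auto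
    consider "v \<in> A" | "v \<in> D" | "v \<in> C" using v by (auto simp: D_def R_def)
    then show False
    proof cases
      case 1
      then have "d \<noteq> v" "x \<noteq> v" using d x AR CR by (auto simp: D_def)
      then have "f v d = f v x" using vp[OF dV] vp[OF xV] by simp
      then show False using A_r(1)[of v d] AC[of v x] 1 d x \<open>d \<noteq> v\<close> DR sym[of v x] by auto
    next
      case 2
      then have "b \<noteq> v" "a \<noteq> v" using b aA by (auto simp: D_def)
      then show False
        using vp[OF bV] vn[of a] A_r(2)[of b v] A_r(2)[of a v] 2 DR b aA by auto
    next
      case 3
      then have "b \<noteq> v" using b AR CR by blast
      then show False using vp[OF bV] vn[of a] C_A[of v b] 3 b by auto
    qed
  qed
  have RD: "R = insert a D" using A_single a by (auto simp: D_def)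
  have aD: "a \<notin> D" using aA by (auto simp: D_def)
  have VD: "V = insert a (C \<union> D)" using RD CV RV by (auto simp: R_def)
  \<comment> \<open>The two cases are the dominating vertex of \<open>V - {x, a, z, y}\<close> lying in \<open>D\<close> or in \<open>C\<close>.\<close>
  have exch: "(\<exists>v\<in>D. \<exists>p. v \<noteq> y \<and> v \<noteq> z \<and> f v y \<noteq> p \<and> f v z \<noteq> p \<and> p \<noteq> r \<and>
                (\<forall>x'\<in>C - {x}. f x' v = p \<and> f x' a = p))
    \<or> (\<exists>v\<in>C - {x}. f v y \<noteq> r \<and> f v z \<noteq> r \<and> (\<forall>d\<in>D - {y, z}. f v d = r) \<and>
                (\<forall>x'\<in>C - {x}. f x' a = f v a))"
    if xyz: "x \<in> C" "y \<in> D" "z \<in> D" "y \<noteq> z" "f x y = r" "f y z \<noteq> r" for x y z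
  proof -
    obtain v p where v: "v \<in> V - {x, a, z, y}"
      and vp: "\<And>u. u \<in> V - {x, a, z, y} \<Longrightarrow> u \<noteq> v \<Longrightarrow> f v u = p"
      and vn: "\<And>x'. x' \<in> {x, a, z, y} \<Longrightarrow> f v x' \<noteq> p"
      by (rule quadrangle_exchange[OF cyc[OF xyz(1) aA xyz(2-)]]) (rule that)
    have DV: "d \<in> V - {x, a, z, y}" if "d \<in> D" "d \<noteq> y" "d \<noteq> z" for d
      using that xyz(1) aD VD CD[OF xyz(1) that(1)] by auto
    have CV': "x' \<in> V - {x, a, z, y}" if "x' \<in> C" "x' \<noteq> x" for x'
      using that CV Ca[OF that(1)] CD[OF that(1) xyz(2)] CD[OF that(1) xyz(3)] by auto
    consider "v \<in> D" | "v \<in> C" using v VD by auto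
    then show ?thesis
    proof cases
      case 1
      then have "f v a = r" using A_r(2)[of a v] aA DR aD by auto
      then have pr: "p \<noteq> r" using vn[of a] by auto
      have "f x' v = p \<and> f x' a = p" if "x' \<in> C - {x}" for x'
      proof -
        have "f x' v = p" using vp[OF CV'[of x']] that CR 1 DR sym[of x' v] by auto
        then show ?thesis using C_two[of x' a v] that pr aA 1 DR by auto
      qed
      then show ?thesis using 1 v vn pr by blast
    next
      case 2
      \<comment> \<open>A third vertex of \<open>D\<close> identifies \<open>p\<close>:
        \<open>f v d\<close> is \<open>r\<close> or \<open>f v a\<close>, and
        \<open>f v a \<noteq> p\<close>.\<close>
      obtain d where d: "d \<in> D" "d \<noteq> y" "d \<noteq> z" using D_avoid by blast
      then have "f v d = p" using vp[OF DV[of d]] 2 CR DR by auto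
      then have pr: "p = r" using C_two[of v a d] vn[of a] 2 aA d DR by auto
      \<comment> \<open>In the triangle \<open>v a x'\<close> the edge \<open>v x'\<close> has
        colour \<open>r\<close> and the edges at \<open>a\<close> do not, so these two
        agree.\<close>
      have "f x' a = f v a" if x': "x' \<in> C - {x}" for x'
      proof (cases "x' = v")
        case False
        then have "f v x' = r" using vp[OF CV'[of x']] x' pr by auto
        then show ?thesis
          using third_colour[of v a x'] AC[OF aA] 2 x' a CV RV CR False sym[of x' a] sym[of x' v]
          by (metis Diff_iff subsetD)
      qed simp
      moreover have "f v e = r" if "e \<in> D - {y, z}" for e
        using vp[OF DV[of e]] that 2 CR DR pr by auto
      ultimately show ?thesis using 2 v vn pr by blast
    qed
  qed
  \<comment> \<open>With \<open>x\<close> different from \<open>u\<close> and \<open>v\<close>, both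
    lie in \<open>C - {x}\<close>, whose edges to \<open>a\<close> have one colour in either case of
    \<open>exch\<close>.\<close>
  have const: "f u a = f v a" if "u \<in> C" "v \<in> C" for u v
  proof -
    obtain x where x: "x \<in> C" "x \<noteq> u" "x \<noteq> v" using C_avoid by blast
    obtain y where y: "y \<in> D" "f x y = r" using ex_r x by blast
    obtain z where z: "z \<in> D" "z \<noteq> y" "f y z \<noteq> r" using ex_z y by blast
    show ?thesis using exch[of x y z] x y z that by (metis Diff_iff singletonD)
  qed
  define \<beta> where "\<beta> = f x0 a"
  have \<beta>: "f x a = \<beta>" if "x \<in> C" for x using const that xyz0 \<beta>_def by blast
  have two: "f x d = r \<or> f x d = \<beta>" if "x \<in> C" "d \<in> D" for x d
    using C_two[of x a d] that aA DR \<beta> by auto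
  have "D \<subseteq> V" "D \<inter> C = {}" "D \<noteq> {}" using DR RV xyz0 by (auto simp: R_def)
  then obtain w g where w: "w \<in> D" and wg: "\<And>u. u \<in> D \<Longrightarrow> u \<noteq> w \<Longrightarrow> f w u = g"
    using dominating_vertex[OF CV pcC] by metis
  have gr: "g \<noteq> r" using ex_z[OF w] wg by auto
  show False
  proof (cases "g = \<beta>")
    case True
    \<comment> \<open>\<open>w\<close> already sends \<open>card V - 6\<close> edges of colour
      \<beta> into \<open>D\<close>, so the degree bound leaves room for at most one into
      \<open>C\<close>.\<close>
    let ?B = "{x \<in> C. f x w = \<beta>}"
    have "card (?B \<union> (D - {w})) + 5 \<le> card V"
    proof (rule mono_neighbours[of w _ \<beta>])
      show "w \<in> V" "?B \<union> (D - {w}) \<subseteq> V" "w \<notin> ?B \<union> (D - {w})"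
        using w \<open>D \<subseteq> V\<close> \<open>D \<inter> C = {}\<close> CV by auto
      show "f w u = \<beta>" if "u \<in> ?B \<union> (D - {w})" for u
        using that wg True sym[of u w] by auto
    qed
    moreover have "card (?B \<union> (D - {w})) = card ?B + card (D - {w})"
      using finC finD \<open>D \<inter> C = {}\<close> by (intro card_Un_disjoint) auto
    moreover have "card D = card V - 5"
      using cardR RD aD finD by simp
    ultimately have "card ?B \<le> 1" using w finD cardV by (simp add: card_Diff_singleton)
    then have uniq: "u = v" if "u \<in> ?B" "v \<in> ?B" for u v
      using that finC by (auto simp: card_le_Suc0_iff_eq)
    have "\<not> C \<subseteq> ?B"
      using \<open>card ?B \<le> 1\<close> cardC card_mono[of ?B C] finC by auto
    then obtain x where x: "x \<in> C" "f x w = r" using two w by blast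
    \<comment> \<open>The first case of \<open>exch\<close> is excluded: its \<open>p\<close> would
      be \<beta>, yet \<open>f v w = \<beta>\<close> for every other \<open>v\<close> in
      \<open>D\<close>.\<close>
    have key: "\<exists>v\<in>?B. f v z \<noteq> r \<and> (\<forall>d\<in>D - {w, z}. f v d = r)" if z: "z \<in> D" "z \<noteq> w" for z
    proof -
      obtain x' where x': "x' \<in> C" "x' \<noteq> x" using C_avoid by blast
      from exch[of x w z] consider
          v p where "v \<in> D" "v \<noteq> w" "f v w \<noteq> p" "f x' a = p"
        | v where "v \<in> C" "f v w \<noteq> r" "f v z \<noteq> r" "\<forall>d\<in>D - {w, z}. f v d = r"
        using x w z wg gr x' by blast
      then show ?thesis
      proof cases
        case 1
        then show ?thesis using wg[of v] sym[of v w] \<beta>[of x'] x' True by auto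
      next
        case 2
        then show ?thesis using two[of v w] w by blast
      qed
    qed
    \<comment> \<open>The single vertex of \<open>?B\<close> has to serve both: its edge to
      \<open>z1\<close> is not \<open>r\<close> by \<open>key\<close> for \<open>z1\<close>, but is
      \<open>r\<close> by \<open>key\<close> for \<open>z2\<close>.\<close>
    obtain z1 where z1: "z1 \<in> D" "z1 \<noteq> w" using D_avoid by blast
    obtain z2 where z2: "z2 \<in> D" "z2 \<noteq> w" "z2 \<noteq> z1" using D_avoid by blast
    show False using key[OF z1] key[OF z2(1,2)] uniq z2 by blast
  next
    case False
    \<comment> \<open>\<open>f w d\<close> is neither \<open>r\<close> nor \<beta>, so different
      values of \<open>f x d\<close> and \<open>f x w\<close> would give a rainbow triangle.\<close>
    have same: "f x d = f x w" if "x \<in> C" "d \<in> D" for x d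
    proof (cases "d = w")
      case neq: False
      show ?thesis
        using third_colour[of x d w] third_colour[of d x w] third_colour[of x w d]
          two[of x d] two[of x w] that w wg[of d] sym[of w d] sym[of d x] False gr neq CR DR RV CV by (metis subsetD)
    qed simp
    then have all_r: "f x d = r" if "x \<in> C" "d \<in> D" for x d
      using ex_r that by metis
    obtain x' where x': "x' \<in> C - {x0}" using C_avoid by blast
    \<comment> \<open>Either case of \<open>exch\<close> yields an edge between \<open>C\<close> and
      \<open>D\<close> that is not of colour \<open>r\<close>.\<close>
    consider v p where "v \<in> D" "p \<noteq> r" "f x' v = p" | v where "v \<in> C" "f v y0 \<noteq> r"
      using exch[OF xyz0] x' by blast
    then show False
    proof cases
      case 1
      then show False using all_r[of x' v] x' by simp
    next
      case 2
      then show False using all_r[of v y0] xyz0(2) by simp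
    qed
  qed
qed

end

section \<open>Translation to cycles and degrees of the graph\<close>

lemma pc_cycle_triangle:
  assumes "complete_graph V E" "rainbow_triangle (\<lambda>u v. col {u, v}) a b c" "{a, b, c} \<subseteq> V"
  shows "pc_cycle V E col [a, b, c]"
proof -
  have e: "cycle_edges [a, b, c] = {{a, b}, {b, c}, {c, a}}"
    by (auto simp: cycle_edges_def setcompr_eq_image lessThan_Suc simp flip: lessThan_def)
  show ?thesis
    using assms unfolding pc_cycle_def is_cycle_def properly_colored_def e
    by (auto simp: rainbow_triangle_def complete_graph_def)
qed

lemma pc_cycle_quadrangle:
  assumes "complete_graph V E" "pc_quadrangle (\<lambda>u v. col {u, v}) a b c d" "{a, b, c, d} \<subseteq> V"
  shows "pc_cycle V E col [a, b, c, d]"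
proof -
  have e: "cycle_edges [a, b, c, d] = {{a, b}, {b, c}, {c, d}, {d, a}}"
    by (auto simp: cycle_edges_def setcompr_eq_image lessThan_Suc simp flip: lessThan_def)
  show ?thesis
    using assms unfolding pc_cycle_def is_cycle_def properly_colored_def e
    by (auto simp: pc_quadrangle_def complete_graph_def)
qed

lemma short_pc_set_imp_pc_cycle:
  assumes "complete_graph V E" "short_pc_set (\<lambda>u v. col {u, v}) S" "S \<subseteq> V"
  shows "\<exists>C. pc_cycle V E col C \<and> set C = S \<and> length C \<le> 4"
  using assms(2) unfolding short_pc_set_def
proof (elim disjE exE conjE)
  fix a b c assume "rainbow_triangle (\<lambda>u v. col {u, v}) a b c" "S = {a, b, c}"
  then show ?thesis
    using pc_cycle_triangle[OF assms(1)] assms(3) by (intro exI[of _ "[a, b, c]"]) auto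
next
  fix a b c d assume "pc_quadrangle (\<lambda>u v. col {u, v}) a b c d" "S = {a, b, c, d}"
  then show ?thesis
    using pc_cycle_quadrangle[OF assms(1)] assms(3) by (intro exI[of _ "[a, b, c, d]"]) auto
qed

lemma mono_degree_le_max_mono_degree:
  assumes "complete_graph V E" "v \<in> V"
  shows "card {u \<in> V. u \<noteq> v \<and> col {v, u} = i} \<le> max_mono_degree V E col"
proof (cases "{u \<in> V. u \<noteq> v \<and> col {v, u} = i} = {}")
  \<comment> \<open>With no such neighbour, \<open>i\<close> may be absent from the graph, and then
    the maximum does not range over it.\<close>
  case True
  then show ?thesis by (metis card.empty zero_le)
next
  case False
  let ?N = "{u \<in> V. u \<noteq> v \<and> col {v, u} = i}" and ?Ei = "color_edges E col i"
  have finV: "finite V" and "E \<subseteq> Pow V"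
    using assms by (auto simp: complete_graph_def simple_graph_def)
  then have finE: "finite E" using finite_subset by blast
  have edge: "{v, u} \<in> E" if "u \<in> ?N" for u
    using assms that by (auto simp: complete_graph_def)
  have "card ?N = card ((\<lambda>u. {v, u}) ` ?N)"
    by (rule card_image[symmetric]) (auto simp: inj_on_def doubleton_eq_iff)
  also have "\<dots> \<le> degree ?Ei v"
    unfolding degree_def using finE edge by (intro card_mono) (auto simp: color_edges_def)
  also have "\<dots> \<le> max_degree V ?Ei"
    unfolding max_degree_def using finV assms by (intro Max_ge) auto
  also have "\<dots> \<le> max_mono_degree V E col"
  proof -
    have "i \<in> col ` E" using False edge by blast
    then show ?thesis
      unfolding max_mono_degree_def using finE by auto
  qed
  finally show ?thesis .
qed

theorem theorem6:
  fixes V :: "'a set" and E :: "'a set set" and col :: "'a set \<Rightarrow> nat" and n :: nat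
  assumes "complete_graph V E"
    and "card V = n"
    and "int (max_mono_degree V E col) \<le> int n - 5"
  shows "\<exists>C D. pc_cycle V E col C \<and> pc_cycle V E col D \<and>
           set C \<inter> set D = {} \<and> length C \<le> 4 \<and> length D \<le> 4"
proof (rule ccontr)
  assume contra: "\<not> ?thesis"
  let ?f = "\<lambda>u v. col {u, v}"
  have finV: "finite V" using assms by (auto simp: complete_graph_def simple_graph_def)
  have deg: "card {u \<in> V. u \<noteq> v \<and> col {v, u} = i} + 5 \<le> card V" if "v \<in> V" for v i
    using mono_degree_le_max_mono_degree[OF assms(1) that, of col i] assms(2,3) by linarith
  \<comment> \<open>The hypothesis alone gives \<open>card V \<ge> 5\<close>; any edge then makes a
    monochromatic degree positive, which gains one more.\<close>
  have n6: "6 \<le> card V"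
  proof -
    have n5: "5 \<le> card V" using assms(2,3) by linarith
    then obtain v where v: "v \<in> V" by fastforce
    have "V - {v} \<noteq> {}"
    proof
      assume "V - {v} = {}"
      then have "card V \<le> card {v}" by (intro card_mono) auto
      then show False using n5 by simp
    qed
    then obtain u where "u \<in> V" "u \<noteq> v" by blast
    then have "u \<in> {x \<in> V. x \<noteq> v \<and> col {v, x} = col {v, u}}" by blast
    then have "card {x \<in> V. x \<noteq> v \<and> col {v, x} = col {v, u}} \<noteq> 0"
      using finV by auto
    then show ?thesis using deg[OF v, of "col {v, u}"] by linarith
  qed
  interpret no_disjoint_short_pc V ?f
  proof
    show "finite V" "6 \<le> card V" by fact+
    show "col {u, v} = col {v, u}" for u v by (simp add: insert_commute)
    show "card {u \<in> V. u \<noteq> v \<and> col {v, u} = i} + 5 \<le> card V" if "v \<in> V" for v i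
      by (rule deg[OF that])
    show "S \<inter> T \<noteq> {}" if ST: "S \<subseteq> V" "T \<subseteq> V" "short_pc_set ?f S" "short_pc_set ?f T" for S T
    proof -
      obtain C where C: "pc_cycle V E col C" "set C = S" "length C \<le> 4"
        using short_pc_set_imp_pc_cycle[OF assms(1) ST(3,1)] by blast
      obtain D where D: "pc_cycle V E col D" "set D = T" "length D \<le> 4"
        using short_pc_set_imp_pc_cycle[OF assms(1) ST(4,2)] by blast
      show ?thesis using C D contra by metis
    qed
  qed
  show False by (rule inconsistent)
qed

end
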